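(* Let $K$ be a field of characteristic $0$, let $V$ be a $K$-vector space of finite dimension $n\ge 2$, let $B:V\times V\to K$ be a non-degenerate symmetric bilinear form, and let $w\in V\setminus\{0\}$ with $B(w,w)\neq 0$. Let $\phi\in\mathrm{End}_K(V)$ have decomposition $$\phi=\phi_0+\frac{\mathrm{wt}(\phi)_{B,w}}{B(w,w)}\phi_{B,w,w}+\phi_{B,w,a}+\phi_{B,b,w}$$ for some $a,b\in\{w\}_B^\perp$ and some $\phi_0\in E^{(0)}(B,w)$ of weight $0$. Then $$B_\phi=B_{\phi_0}+\frac{\mathrm{wt}(\phi)_{B,w}^2}{B(w,w)^2}B_{\phi_{B,w,w}}+B_{\phi_{B,w,a}}+B_{\phi_{B,b,w}}+2\left(B_{\phi_0,\phi_{B,b,w}}+\frac{\mathrm{wt}(\phi)_{B,w}}{B(w,w)}B_{\phi_{B,w,w},\phi_{B,w,a}}\right).$$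
   Context: Write $\{w\}_B^\perp=\{u\in V : B(u,w)=0\}$ and $$E^{(0)}(B,w)=\{\phi\in\mathrm{End}_K(V) : B(u,\phi(w))=B(w,\phi(u))=0 \text{ for all } u\in\{w\}_B^\perp\}.$$ The weight of an endomorphism $\phi$ is $\mathrm{wt}(\phi)_{B,w}=B(w,\phi(w))/B(w,w)$. For $u,v\in V$, $\phi_{B,u,v}\in\mathrm{End}_K(V)$ is defined by $\phi_{B,u,v}(x)=B(v,x)u$. For $\phi_1,\phi_2\in\mathrm{End}_K(V)$, $B_{\phi_1,\phi_2}$ is the symmetric bilinear form on $V$ given by $$B_{\phi_1,\phi_2}(x,y)=\tfrac12\big(B(\phi_1(x),\phi_2(y))+B(\phi_1(y),\phi_2(x))\big),$$ and $B_\phi=B_{\phi,\phi}$, i.e. $B_\phi(x,y)=B(\phi(x),\phi(y))$. *)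

theory Defs
  imports Complex_Main
begin

text \<open>A \<open>K\<close>-vector space is an abelian group type \<open>'v\<close> together with an explicit scalar
  multiplication \<open>s :: 'k \<Rightarrow> 'v \<Rightarrow> 'v\<close> satisfying the locale predicate \<open>vector_space\<close>.
  A bilinear form is a curried function \<open>'v \<Rightarrow> 'v \<Rightarrow> 'k\<close>; \<open>K\<close> is a vector
  space over itself via multiplication.\<close>

definition symmetric_bilinear_form ::
    "('k::field \<Rightarrow> 'v::ab_group_add \<Rightarrow> 'v) \<Rightarrow> ('v \<Rightarrow> 'v \<Rightarrow> 'k) \<Rightarrow> bool" where
  "symmetric_bilinear_form s B \<longleftrightarrow>
     (\<forall>x. Vector_Spaces.linear s (*) (\<lambda>y. B x y)) \<and>
     (\<forall>y. Vector_Spaces.linear s (*) (\<lambda>x. B x y)) \<and>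
     (\<forall>x y. B x y = B y x)"

text \<open>One-sided non-degeneracy, to be used for symmetric forms.\<close>

definition nondegenerate_form :: "('v::zero \<Rightarrow> 'v \<Rightarrow> 'k::zero) \<Rightarrow> bool" where
  "nondegenerate_form B \<longleftrightarrow> (\<forall>x. (\<forall>y. B x y = 0) \<longrightarrow> x = 0)"

definition End_space ::
    "('k::field \<Rightarrow> 'v::ab_group_add \<Rightarrow> 'v) \<Rightarrow> ('v \<Rightarrow> 'v) set" where
  "End_space s = {\<phi>. Vector_Spaces.linear s s \<phi>}"

definition perp :: "('v \<Rightarrow> 'v \<Rightarrow> 'k::zero) \<Rightarrow> 'v \<Rightarrow> 'v set" where
  "perp B w = {u. B u w = 0}"

definition E0 ::
    "('k::field \<Rightarrow> 'v::ab_group_add \<Rightarrow> 'v) \<Rightarrow> ('v \<Rightarrow> 'v \<Rightarrow> 'k) \<Rightarrow> 'v \<Rightarrow> ('v \<Rightarrow> 'v) set" where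
  "E0 s B w = {\<phi> \<in> End_space s. \<forall>u \<in> perp B w. B u (\<phi> w) = 0 \<and> B w (\<phi> u) = 0}"

definition wt :: "('v \<Rightarrow> 'v \<Rightarrow> 'k::field) \<Rightarrow> 'v \<Rightarrow> ('v \<Rightarrow> 'v) \<Rightarrow> 'k" where
  "wt B w \<phi> = B w (\<phi> w) / B w w"

definition phi_map ::
    "('k \<Rightarrow> 'v \<Rightarrow> 'v) \<Rightarrow> ('v \<Rightarrow> 'v \<Rightarrow> 'k) \<Rightarrow> 'v \<Rightarrow> 'v \<Rightarrow> 'v \<Rightarrow> 'v" where
  "phi_map s B u v = (\<lambda>x. s (B v x) u)"

definition form_pair ::
    "('v \<Rightarrow> 'v \<Rightarrow> 'k::field) \<Rightarrow> ('v \<Rightarrow> 'v) \<Rightarrow> ('v \<Rightarrow> 'v) \<Rightarrow> 'v \<Rightarrow> 'v \<Rightarrow> 'k" where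
  "form_pair B \<phi>\<^sub>1 \<phi>\<^sub>2 =
     (\<lambda>x y. 1 / 2 * (B (\<phi>\<^sub>1 x) (\<phi>\<^sub>2 y) + B (\<phi>\<^sub>1 y) (\<phi>\<^sub>2 x)))"

definition form_of ::
    "('v \<Rightarrow> 'v \<Rightarrow> 'k::field) \<Rightarrow> ('v \<Rightarrow> 'v) \<Rightarrow> 'v \<Rightarrow> 'v \<Rightarrow> 'k" where
  "form_of B \<phi> = form_pair B \<phi> \<phi>"

lemma form_of_apply:
  fixes B :: "'v::ab_group_add \<Rightarrow> 'v \<Rightarrow> 'k::field_char_0"
  assumes "symmetric_bilinear_form s B"
  shows "form_of B \<phi> x y = B (\<phi> x) (\<phi> y)"
proof -
  have "B (\<phi> y) (\<phi> x) = B (\<phi> x) (\<phi> y)"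
    using assms by (simp add: symmetric_bilinear_form_def)
  then show ?thesis
    by (simp add: form_of_def form_pair_def)
qed

end

theory Submission
  imports Defs
begin

text \<open>
  The asserted identity is a polarization formula in which most cross terms vanish.
  Group the decomposition as
  \<open>\<phi> = (\<phi>\<^sub>0 + \<phi>\<^bsub>B,b,w\<^esub>) + (c \<phi>\<^bsub>B,w,w\<^esub> + \<phi>\<^bsub>B,w,a\<^esub>)\<close>, where \<open>c = wt \<phi> / B w w\<close>.
  The second group takes values in the line spanned by \<open>w\<close>.  The first takes values in the
  orthogonal complement of \<open>w\<close>: for the map \<open>x \<mapsto> B w x \<cdot> b\<close> because \<open>b\<close> lies there, and for
  \<open>\<phi>\<^sub>0\<close> because membership in \<open>E0\<close> controls \<open>\<phi>\<^sub>0\<close> on the complement of \<open>w\<close>, the vanishing weight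
  controls it at \<open>w\<close>, and the two together span the space, \<open>w\<close> being anisotropic
  (\<open>weight_zero_image_perp\<close>).  Hence the two groups are orthogonal and their forms add
  (\<open>form_of_add_orthogonal\<close>).  Polarizing inside each group (\<open>form_of_add\<close>) leaves exactly
  the two mixed terms of the formula.
\<close>

lemma symmetric_bilinear_formD:
  assumes "symmetric_bilinear_form s B"
  shows "B (x + y) z = B x z + B y z"
    and "B z (x + y) = B z x + B z y"
    and "B (s c x) z = c * B x z"
    and "B z (s c x) = c * B z x"
    and "B x y = B y x"
  using assms by (simp_all add: symmetric_bilinear_form_def Vector_Spaces.linear_iff)

lemma form_of_add:
  fixes B :: "'v::ab_group_add \<Rightarrow> 'v \<Rightarrow> 'k::field_char_0"
  assumes B: "symmetric_bilinear_form s B"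
  shows "form_of B (\<lambda>x. f x + g x) x y =
    form_of B f x y + form_of B g x y + 2 * form_pair B f g x y"
  using symmetric_bilinear_formD(5)[OF B, of "g x" "f y"]
  by (simp add: form_of_apply[OF B] form_pair_def symmetric_bilinear_formD(1,2)[OF B])

lemma form_of_add_orthogonal:
  fixes B :: "'v::ab_group_add \<Rightarrow> 'v \<Rightarrow> 'k::field_char_0"
  assumes B: "symmetric_bilinear_form s B"
    and "\<And>x y. B (f x) (g y) = 0"
  shows "form_of B (\<lambda>x. f x + g x) x y = form_of B f x y + form_of B g x y"
  using assms(2) by (simp add: form_of_add[OF B] form_pair_def)

lemma form_of_scale:
  fixes B :: "'v::ab_group_add \<Rightarrow> 'v \<Rightarrow> 'k::field_char_0"
  assumes B: "symmetric_bilinear_form s B"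
  shows "form_of B (\<lambda>x. s c (f x)) x y = c\<^sup>2 * form_of B f x y"
  by (simp add: form_of_apply[OF B] symmetric_bilinear_formD(3,4)[OF B] power2_eq_square)

lemma form_pair_scale_left:
  assumes B: "symmetric_bilinear_form s B"
  shows "form_pair B (\<lambda>x. s c (f x)) g x y = c * form_pair B f g x y"
  by (simp add: form_pair_def symmetric_bilinear_formD(3)[OF B] algebra_simps)

text \<open>Since \<open>B w w \<noteq> 0\<close>, every \<open>x\<close> is the sum of a multiple of \<open>w\<close> and a vector orthogonal
  to \<open>w\<close>; the weight condition handles the former and the defining condition of \<open>E0\<close>
  the latter.\<close>

lemma weight_zero_image_perp:
  assumes B: "symmetric_bilinear_form s B"
    and w: "B w w \<noteq> 0"
    and f: "f \<in> E0 s B w"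
    and wt: "wt B w f = 0"
  shows "f x \<in> perp B w"
proof -
  define c where "c = B x w / B w w"
  define u where "u = x + s (- c) w"
  have lin: "Vector_Spaces.linear s s f"
    using f by (simp add: E0_def End_space_def)
  have "u \<in> perp B w"
    using w by (simp add: perp_def u_def c_def symmetric_bilinear_formD(1,3)[OF B])
  then have "B w (f u) = 0"
    using f by (simp add: E0_def)
  moreover have "B w (f w) = 0"
    using wt w by (simp add: wt_def)
  moreover have "B w (f u) = B w (f x) - c * B w (f w)"
    using lin by (simp add: Vector_Spaces.linear_iff u_def symmetric_bilinear_formD(2,4)[OF B])
  ultimately have "B w (f x) = 0"
    by simp
  then show ?thesis
    by (simp add: perp_def symmetric_bilinear_formD(5)[OF B, of "f x" w])
qed

theorem proposition3p1:
  fixes s :: "'k::field_char_0 \<Rightarrow> 'v::ab_group_add \<Rightarrow> 'v"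
    and Basis :: "'v set"
    and n :: nat
    and B :: "'v \<Rightarrow> 'v \<Rightarrow> 'k"
    and w a b :: 'v
    and \<phi> \<phi>\<^sub>0 :: "'v \<Rightarrow> 'v"
  assumes "finite_dimensional_vector_space s Basis"
    and "vector_space.dim s (UNIV :: 'v set) = n"
    and "n \<ge> 2"
    and "symmetric_bilinear_form s B"
    and "nondegenerate_form B"
    and "w \<noteq> 0"
    and "B w w \<noteq> 0"
    and "\<phi> \<in> End_space s"
    and "a \<in> perp B w"
    and "b \<in> perp B w"
    and "\<phi>\<^sub>0 \<in> E0 s B w"
    and "wt B w \<phi>\<^sub>0 = 0"
    and "\<phi> = (\<lambda>x. \<phi>\<^sub>0 x + s (wt B w \<phi> / B w w) (phi_map s B w w x)
                  + phi_map s B w a x + phi_map s B b w x)"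
  shows "form_of B \<phi> =
    (\<lambda>x y. form_of B \<phi>\<^sub>0 x y
       + (wt B w \<phi>)\<^sup>2 / (B w w)\<^sup>2 * form_of B (phi_map s B w w) x y
       + form_of B (phi_map s B w a) x y
       + form_of B (phi_map s B b w) x y
       + 2 * (form_pair B \<phi>\<^sub>0 (phi_map s B b w) x y
              + wt B w \<phi> / B w w * form_pair B (phi_map s B w w) (phi_map s B w a) x y))"
proof (intro ext)
  fix x y
  note B = \<open>symmetric_bilinear_form s B\<close>
  define c where "c = wt B w \<phi> / B w w"
  let ?ww = "phi_map s B w w" and ?wa = "phi_map s B w a" and ?bw = "phi_map s B b w"
  let ?P = "\<lambda>x. \<phi>\<^sub>0 x + ?bw x" and ?L = "\<lambda>x. s c (?ww x) + ?wa x"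
  have "\<phi> = (\<lambda>x. \<phi>\<^sub>0 x + s c (?ww x) + ?wa x + ?bw x)"
    unfolding c_def by (rule assms(13))
  then have split: "\<phi> = (\<lambda>x. ?P x + ?L x)"
    by (simp add: algebra_simps)
  have "B (\<phi>\<^sub>0 x) w = 0" for x
    using weight_zero_image_perp[OF B assms(7,11,12)] by (simp add: perp_def)
  moreover have "B b w = 0"
    using assms(10) by (simp add: perp_def)
  ultimately have orth: "B (?P x) (?L y) = 0" for x y
    by (simp add: phi_map_def symmetric_bilinear_formD(1-4)[OF B])
  have "form_of B \<phi> x y = form_of B ?P x y + form_of B ?L x y"
    unfolding split by (rule form_of_add_orthogonal[OF B]) (rule orth)
  moreover have "form_of B ?P x y =
      form_of B \<phi>\<^sub>0 x y + form_of B ?bw x y + 2 * form_pair B \<phi>\<^sub>0 ?bw x y"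
    by (rule form_of_add[OF B])
  moreover have "form_of B ?L x y =
      c\<^sup>2 * form_of B ?ww x y + form_of B ?wa x y + 2 * (c * form_pair B ?ww ?wa x y)"
    by (simp only: form_of_add[OF B] form_of_scale[OF B] form_pair_scale_left[OF B])
  ultimately show "form_of B \<phi> x y = form_of B \<phi>\<^sub>0 x y
       + (wt B w \<phi>)\<^sup>2 / (B w w)\<^sup>2 * form_of B ?ww x y
       + form_of B ?wa x y
       + form_of B ?bw x y
       + 2 * (form_pair B \<phi>\<^sub>0 ?bw x y
              + wt B w \<phi> / B w w * form_pair B ?ww ?wa x y)"
    by (simp only: power_divide[symmetric] c_def[symmetric] distrib_left add_ac)
qed

end
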